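(* In the spatial regression model with bivariate coding described in the context, let $\alpha_1,\dots,\alpha_6$ be the statistics defined there. The bivariate marginal maximum likelihood (BML) estimators of the vector of parameters $\theta=(\beta,\psi,\sigma^2)$, i.e. the maximum likelihood estimators based on the bivariate marginal (pseudo) log-likelihood $l(\beta,\sigma^2,\psi)$ given in the context, are given by the solution of the system of equations $$\begin{cases}\hat\beta_{BML}=\dfrac{\hat\psi_{BML}\alpha_4-\alpha_3}{2\hat\psi_{BML}\alpha_5-\alpha_1},\\[2ex] \hat\sigma^2_{BML}=\dfrac{\alpha_2+\hat\beta_{BML}^2\alpha_1-2\hat\beta_{BML}\alpha_3-2\hat\psi_{BML}\alpha_6-2\hat\psi_{BML}\hat\beta_{BML}^2\alpha_5+2\hat\psi_{BML}\hat\beta_{BML}\alpha_4}{2q(1-\hat\psi_{BML}^2)},\\[2ex] \hat\psi_{BML}=\dfrac{\alpha_6-\hat\beta_{BML}\alpha_4+\hat\beta_{BML}^2\alpha_5}{q\hat\sigma^2_{BML}}.\end{cases}$$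
   Context: Model: $y_i=\beta x_i+\varepsilon_i$, $i=1,\dots,n$ indexing spatial units, with scalar random $y_i$, non-stochastic scalar $x_i$ (both centered on their expected values), scalar parameter $\beta$ and unobservable disturbance $\varepsilon_i$. $N(i)$ denotes the set of neighbors of location $i$, however defined. Assumption on the disturbances: for all $i$ and all $l\in N(i)$, $(\varepsilon_i,\varepsilon_l)$ is bivariate Gaussian with mean $0$ and covariance matrix $\sigma^2\begin{pmatrix}1&\psi\\ \psi&1\end{pmatrix}$, where $\psi\in[-1,+1]$ is the spatial error correlation parameter. Bivariate coding: $q<n$ of the spatial units, labelled $i=1,\dots,q$, are selected, and for each of them one further unit $l=l(i)$ is chosen randomly in $N(i)$, giving $q$ pairs ($2q$ units). The two disturbances $\varepsilon_i,\varepsilon_l$ in a pair are spatially dependent, while the pairs $\{\varepsilon_i,\varepsilon_l\}$ and $\{\varepsilon_j,\varepsilon_k\}$ (with $k\in N(j)$) are stochastically independent provided $j,k\notin N(i)\cup N(l)$; the pairs are selected so that different pairs are independent. The (pseudo) log-likelihood associated with the $2q$ selected units is $$l(\beta,\sigma^2,\psi)=-q\ln(2\pi)-q\ln(\sigma^2)-\tfrac q2\ln(1-\psi^2)-\frac{1}{2\sigma^2(1-\psi^2)}\sum_{i=1}^q\left[\varepsilon_i^2-2\psi\varepsilon_i\varepsilon_l+\varepsilon_l^2\right],$$ with $\varepsilon_i=y_i-\beta x_i$, $\varepsilon_l=y_l-\beta x_l$, $l=l(i)$. Sufficient statistics (all sums over the $q$ pairs $(i,l)$, $i=1,\dots,q$,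 $l=l(i)$): $\alpha_1=\sum x_i^2+\sum x_l^2$, $\alpha_2=\sum y_i^2+\sum y_l^2$, $\alpha_3=\sum x_iy_i+\sum x_ly_l$, $\alpha_4=\sum x_iy_l+\sum x_ly_i$, $\alpha_5=\sum x_ix_l$, $\alpha_6=\sum y_iy_l$. *)

theory Defs
  imports "HOL-Probability.Probability"
begin

text \<open>A Gaussian variable with variance \<open>0\<close> is almost surely constant; this case is needed
  because the error correlation is allowed to be \<open>1\<close> or \<open>-1\<close>.\<close>

definition normal_rv :: "'w measure \<Rightarrow> ('w \<Rightarrow> real) \<Rightarrow> real \<Rightarrow> real \<Rightarrow> bool" where
  "normal_rv M X \<mu> v \<longleftrightarrow>
     X \<in> borel_measurable M \<and> 0 \<le> v \<and>
     (if v = 0 then AE \<omega> in M. X \<omega> = \<mu>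
      else distributed M lborel X (normal_density \<mu> (sqrt v)))"

text \<open>A random vector is Gaussian iff all linear combinations of its entries are Gaussian.\<close>

definition gaussian_vector ::
    "'w measure \<Rightarrow> ('w \<Rightarrow> real ^ 'k) \<Rightarrow> real ^ 'k \<Rightarrow> real ^ 'k ^ 'k \<Rightarrow> bool" where
  "gaussian_vector M X m S \<longleftrightarrow>
     X \<in> borel_measurable M \<and>
     (\<forall>a. normal_rv M (\<lambda>\<omega>. a \<bullet> X \<omega>) (a \<bullet> m) (a \<bullet> (S *v a)))"

definition error_pair :: "(nat \<Rightarrow> 'w \<Rightarrow> real) \<Rightarrow> nat \<Rightarrow> nat \<Rightarrow> 'w \<Rightarrow> real ^ 2" where
  "error_pair \<epsilon> i k \<omega> = vector [\<epsilon> i \<omega>, \<epsilon> k \<omega>]"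

text \<open>
  The units are \<open>1, \<dots>, n\<close>, the coded pairs are \<open>(i, l i)\<close> for \<open>i = 1, \<dots>, q\<close>, and \<open>l\<close> is a
  realisation of the random choice of neighbours. The true parameters are \<open>\<beta>\<close>, \<open>\<psi>\<close> and the
  variance \<open>\<sigma>2\<close>. The neighbourhoods need not be symmetric, so in \<open>separated_indep\<close> the
  disjointness of the two pairs has to be required separately.
\<close>

locale bivariate_coding_model = prob_space M
  for M :: "'w measure" +
  fixes n q :: nat
    and N :: "nat \<Rightarrow> nat set"
    and l :: "nat \<Rightarrow> nat"
    and x :: "nat \<Rightarrow> real"
    and y \<epsilon> :: "nat \<Rightarrow> 'w \<Rightarrow> real"
    and \<beta> \<psi> \<sigma>2 :: real
  assumes q_pos: "1 \<le> q" and q_less: "q < n"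
    and neighbours: "\<And>i. i \<in> {1..n} \<Longrightarrow> N i \<subseteq> {1..n}"
    and partner: "\<And>i. i \<in> {1..q} \<Longrightarrow> l i \<in> N i"
    and coded_units: "card ({1..q} \<union> l ` {1..q}) = 2 * q"
    and psi_range: "\<psi> \<in> {-1..1}" and variance_pos: "0 < \<sigma>2"
    and error_rv: "\<And>i. i \<in> {1..n} \<Longrightarrow> \<epsilon> i \<in> borel_measurable M"
    and regression: "\<And>i \<omega>. i \<in> {1..n} \<Longrightarrow> \<omega> \<in> space M \<Longrightarrow> y i \<omega> = \<beta> * x i + \<epsilon> i \<omega>"
    and bivariate_gaussian: "\<And>i k. i \<in> {1..n} \<Longrightarrow> k \<in> N i \<Longrightarrow>
      gaussian_vector M (error_pair \<epsilon> i k) 0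
        (\<sigma>2 *\<^sub>R vector [vector [1, \<psi>], vector [\<psi>, 1]])"
    and separated_indep: "\<And>i h j k. i \<in> {1..n} \<Longrightarrow> h \<in> N i \<Longrightarrow> j \<in> {1..n} \<Longrightarrow> k \<in> N j \<Longrightarrow>
      {i, h} \<inter> {j, k} = {} \<Longrightarrow> j \<notin> N i \<union> N h \<Longrightarrow> k \<notin> N i \<union> N h \<Longrightarrow>
      indep_var borel (error_pair \<epsilon> i h) borel (error_pair \<epsilon> j k)"
    and coded_pairs_indep:
      "indep_vars (\<lambda>_. borel) (\<lambda>i. error_pair \<epsilon> i (l i)) {1..q}"

text \<open>In what follows \<open>y\<close> is a realisation of the dependent variable, and parameter vectors
  are ordered as \<open>(\<beta>, \<psi>, \<sigma>2)\<close>.\<close>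

definition bml_loglik ::
    "nat \<Rightarrow> (nat \<Rightarrow> nat) \<Rightarrow> (nat \<Rightarrow> real) \<Rightarrow> (nat \<Rightarrow> real) \<Rightarrow> real \<times> real \<times> real \<Rightarrow> real" where
  "bml_loglik q l x y = (\<lambda>(\<beta>, \<psi>, \<sigma>2).
     let e = (\<lambda>i. y i - \<beta> * x i) in
     - real q * ln (2 * pi) - real q * ln \<sigma>2 - real q / 2 * ln (1 - \<psi>\<^sup>2)
     - 1 / (2 * \<sigma>2 * (1 - \<psi>\<^sup>2)) *
       (\<Sum>i=1..q. (e i)\<^sup>2 - 2 * \<psi> * e i * e (l i) + (e (l i))\<^sup>2))"

text \<open>The endpoints \<open>\<psi> = 1\<close> and \<open>\<psi> = -1\<close> are excluded because the log-likelihood is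
  undefined there.\<close>

definition bml_params :: "(real \<times> real \<times> real) set" where
  "bml_params = {(\<beta>, \<psi>, \<sigma>2). - 1 < \<psi> \<and> \<psi> < 1 \<and> 0 < \<sigma>2}"

definition is_bml_estimate ::
    "nat \<Rightarrow> (nat \<Rightarrow> nat) \<Rightarrow> (nat \<Rightarrow> real) \<Rightarrow> (nat \<Rightarrow> real) \<Rightarrow> real \<times> real \<times> real \<Rightarrow> bool" where
  "is_bml_estimate q l x y \<theta> \<longleftrightarrow> is_arg_max (bml_loglik q l x y) (\<lambda>\<theta>. \<theta> \<in> bml_params) \<theta>"

definition likelihood_equations ::
    "nat \<Rightarrow> (nat \<Rightarrow> nat) \<Rightarrow> (nat \<Rightarrow> real) \<Rightarrow> (nat \<Rightarrow> real) \<Rightarrow> real \<times> real \<times> real \<Rightarrow> bool" where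
  "likelihood_equations q l x y = (\<lambda>(\<beta>, \<psi>, \<sigma>2).
     ((\<lambda>b. bml_loglik q l x y (b, \<psi>, \<sigma>2)) has_real_derivative 0) (at \<beta>) \<and>
     ((\<lambda>p. bml_loglik q l x y (\<beta>, p, \<sigma>2)) has_real_derivative 0) (at \<psi>) \<and>
     ((\<lambda>s. bml_loglik q l x y (\<beta>, \<psi>, s)) has_real_derivative 0) (at \<sigma>2))"

definition alpha1 :: "nat \<Rightarrow> (nat \<Rightarrow> nat) \<Rightarrow> (nat \<Rightarrow> real) \<Rightarrow> real" where
  "alpha1 q l x = (\<Sum>i=1..q. (x i)\<^sup>2) + (\<Sum>i=1..q. (x (l i))\<^sup>2)"

definition alpha2 :: "nat \<Rightarrow> (nat \<Rightarrow> nat) \<Rightarrow> (nat \<Rightarrow> real) \<Rightarrow> real" where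
  "alpha2 q l y = (\<Sum>i=1..q. (y i)\<^sup>2) + (\<Sum>i=1..q. (y (l i))\<^sup>2)"

definition alpha3 :: "nat \<Rightarrow> (nat \<Rightarrow> nat) \<Rightarrow> (nat \<Rightarrow> real) \<Rightarrow> (nat \<Rightarrow> real) \<Rightarrow> real" where
  "alpha3 q l x y = (\<Sum>i=1..q. x i * y i) + (\<Sum>i=1..q. x (l i) * y (l i))"

definition alpha4 :: "nat \<Rightarrow> (nat \<Rightarrow> nat) \<Rightarrow> (nat \<Rightarrow> real) \<Rightarrow> (nat \<Rightarrow> real) \<Rightarrow> real" where
  "alpha4 q l x y = (\<Sum>i=1..q. x i * y (l i)) + (\<Sum>i=1..q. x (l i) * y i)"

definition alpha5 :: "nat \<Rightarrow> (nat \<Rightarrow> nat) \<Rightarrow> (nat \<Rightarrow> real) \<Rightarrow> real" where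
  "alpha5 q l x = (\<Sum>i=1..q. x i * x (l i))"

definition alpha6 :: "nat \<Rightarrow> (nat \<Rightarrow> nat) \<Rightarrow> (nat \<Rightarrow> real) \<Rightarrow> real" where
  "alpha6 q l y = (\<Sum>i=1..q. y i * y (l i))"

definition bml_system ::
    "nat \<Rightarrow> (nat \<Rightarrow> nat) \<Rightarrow> (nat \<Rightarrow> real) \<Rightarrow> (nat \<Rightarrow> real) \<Rightarrow> real \<times> real \<times> real \<Rightarrow> bool" where
  "bml_system q l x y = (\<lambda>(\<beta>, \<psi>, \<sigma>2).
     let \<alpha>1 = alpha1 q l x; \<alpha>2 = alpha2 q l y; \<alpha>3 = alpha3 q l x y;
         \<alpha>4 = alpha4 q l x y; \<alpha>5 = alpha5 q l x; \<alpha>6 = alpha6 q l y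
     in \<beta> = (\<psi> * \<alpha>4 - \<alpha>3) / (2 * \<psi> * \<alpha>5 - \<alpha>1) \<and>
        \<sigma>2 = (\<alpha>2 + \<beta>\<^sup>2 * \<alpha>1 - 2 * \<beta> * \<alpha>3 - 2 * \<psi> * \<alpha>6 - 2 * \<psi> * \<beta>\<^sup>2 * \<alpha>5 + 2 * \<psi> * \<beta> * \<alpha>4)
              / (2 * real q * (1 - \<psi>\<^sup>2)) \<and>
        \<psi> = (\<alpha>6 - \<beta> * \<alpha>4 + \<beta>\<^sup>2 * \<alpha>5) / (real q * \<sigma>2))"

end

theory Submission
  imports Defs
begin

text \<open>
  The sum in the log-likelihood is \<open>A - 2 \<psi> C\<close>, where \<open>A\<close> and \<open>C\<close> are quadratic polynomials in
  \<open>\<beta>\<close> whose coefficients are the statistics \<open>\<alpha>\<^sub>1, \<dots>, \<alpha>\<^sub>6\<close>. Setting the three partial derivatives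
  to zero gives the system: the \<open>\<beta>\<close>-equation can be solved since \<open>2 \<bar>\<alpha>\<^sub>5\<bar> \<le> \<alpha>\<^sub>1\<close> and \<open>\<bar>\<psi>\<bar> < 1\<close>,
  and the \<open>\<sigma>\<^sup>2\<close>-equation reduces the \<open>\<psi>\<close>-equation to \<open>C = q \<psi> \<sigma>\<^sup>2\<close>. As the parameter set is open
  in each coordinate, maximisers are critical points.
\<close>

text \<open>The residual sum of squares over both members of all pairs at slope \<open>b\<close>,
  the polynomial \<open>A\<close> in the terms above.\<close>

definition error_squares ::
    "nat \<Rightarrow> (nat \<Rightarrow> nat) \<Rightarrow> (nat \<Rightarrow> real) \<Rightarrow> (nat \<Rightarrow> real) \<Rightarrow> real \<Rightarrow> real" where
  "error_squares q l x y b = alpha2 q l y - 2 * b * alpha3 q l x y + b\<^sup>2 * alpha1 q l x"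

text \<open>The sum over the pairs of the products of the two residuals at slope \<open>b\<close>,
  the polynomial \<open>C\<close>.\<close>

definition error_products ::
    "nat \<Rightarrow> (nat \<Rightarrow> nat) \<Rightarrow> (nat \<Rightarrow> real) \<Rightarrow> (nat \<Rightarrow> real) \<Rightarrow> real \<Rightarrow> real" where
  "error_products q l x y b = alpha6 q l y - b * alpha4 q l x y + b\<^sup>2 * alpha5 q l x"

lemma bml_loglik_eq:
  "bml_loglik q l x y (b, p, s) =
     - real q * ln (2 * pi) - real q * ln s - real q / 2 * ln (1 - p\<^sup>2) -
     (error_squares q l x y b - 2 * p * error_products q l x y b) / (2 * s * (1 - p\<^sup>2))"
proof -
  have "(\<Sum>i=1..q. (y i - b * x i)\<^sup>2 - 2 * p * (y i - b * x i) * (y (l i) - b * x (l i)) +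
          (y (l i) - b * x (l i))\<^sup>2) =
        error_squares q l x y b - 2 * p * error_products q l x y b"
    unfolding error_squares_def error_products_def alpha1_def alpha2_def alpha3_def alpha4_def
      alpha5_def alpha6_def distrib_left sum.distrib[symmetric] sum_distrib_left
      sum_subtractf[symmetric]
    \<comment> \<open>Both sides are now single sums over the pairs, so a polynomial identity for
      each pair suffices.\<close>
    by (intro sum.cong refl) (simp add: power2_eq_square algebra_simps)
  then show ?thesis
    by (simp add: bml_loglik_def)
qed

text \<open>For each pair, (|u| - |v|)^2 \<ge> 0 bounds twice the product; summation and the
  triangle inequality finish.\<close>

lemma two_alpha5_le_alpha1: "2 * \<bar>alpha5 q l x\<bar> \<le> alpha1 q l x"
proof -
  have "2 * \<bar>u * v\<bar> \<le> u\<^sup>2 + v\<^sup>2" for u v :: real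
    using zero_le_power2[of "\<bar>u\<bar> - \<bar>v\<bar>"] by (simp add: power2_diff abs_mult)
  then have "(\<Sum>i=1..q. 2 * \<bar>x i * x (l i)\<bar>) \<le> (\<Sum>i=1..q. (x i)\<^sup>2 + (x (l i))\<^sup>2)"
    by (intro sum_mono)
  moreover have "\<bar>alpha5 q l x\<bar> \<le> (\<Sum>i=1..q. \<bar>x i * x (l i)\<bar>)"
    unfolding alpha5_def by (rule sum_abs)
  ultimately show ?thesis
    by (simp add: alpha1_def sum.distrib sum_distrib_left[symmetric])
qed

text \<open>This makes the denominator in the slope equation negative, hence nonzero. Strictness
  comes from |p| < 1 if \<open>alpha5\<close> is nonzero, and otherwise from \<open>alpha1\<close>
  being nonnegative and nonzero.\<close>

lemma two_correlation_alpha5_less_alpha1: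
  assumes "alpha1 q l x \<noteq> 0" "\<bar>p\<bar> < 1"
  shows "2 * p * alpha5 q l x < alpha1 q l x"
proof (cases "alpha5 q l x = 0")
  case True
  then show ?thesis
    using two_alpha5_le_alpha1[of q l x] assms(1) by simp
next
  case False
  have "p * alpha5 q l x \<le> \<bar>p\<bar> * \<bar>alpha5 q l x\<bar>"
    by (simp add: abs_mult[symmetric])
  also have "\<dots> < \<bar>alpha5 q l x\<bar>"
    using False assms(2) by simp
  finally show ?thesis
    using two_alpha5_le_alpha1[of q l x] by simp
qed

lemma one_minus_square_pos: "\<bar>p\<bar> < 1 \<Longrightarrow> 0 < 1 - (p::real)\<^sup>2"
  using abs_square_less_1[of p] by simp

text \<open>The slope enters only the numerator, so the denominator is a constant factor; if it is
  0, the quotient and its derivative are 0 by the convention for division.\<close>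

lemma bml_loglik_deriv_beta:
  "((\<lambda>b. bml_loglik q l x y (b, p, s)) has_real_derivative
     (alpha3 q l x y - p * alpha4 q l x y - b * (alpha1 q l x - 2 * p * alpha5 q l x)) /
       (s * (1 - p\<^sup>2))) (at b)"
proof -
  have "((\<lambda>b. c - (error_squares q l x y b - 2 * p * error_products q l x y b) / (2 * D))
      has_real_derivative
      (alpha3 q l x y - p * alpha4 q l x y - b * (alpha1 q l x - 2 * p * alpha5 q l x)) / D) (at b)"
    for c D :: real
    unfolding error_squares_def error_products_def divide_inverse
    by (auto intro!: derivative_eq_intros simp: algebra_simps)
  then show ?thesis
    unfolding bml_loglik_eq by (simp only: mult.assoc)
qed

text \<open>The factor A - 2pC is left unexpanded so that the variance equation can later be
  substituted for it.\<close>

lemma bml_loglik_deriv_psi: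
  assumes "\<bar>p\<bar> < 1" "0 < s"
  shows "((\<lambda>p. bml_loglik q l x y (b, p, s)) has_real_derivative
     real q * p / (1 - p\<^sup>2) + error_products q l x y b / (s * (1 - p\<^sup>2)) -
     p * (error_squares q l x y b - 2 * p * error_products q l x y b) / (s * (1 - p\<^sup>2)\<^sup>2)) (at p)"
proof -
  define D where "D = 1 - p\<^sup>2"
  have D: "D > 0"
    using one_minus_square_pos[OF assms(1)] by (simp add: D_def)
  have ln: "((\<lambda>p. ln (1 - p\<^sup>2)) has_real_derivative - (2 * p) / D) (at p)"
    using D by (auto intro!: derivative_eq_intros simp: D_def)
  have quotient: "((\<lambda>p. (A - 2 * p * C) / (2 * s * (1 - p\<^sup>2))) has_real_derivative
      (- 2 * C * (2 * s * D) + (A - 2 * p * C) * (4 * s * p)) / (2 * s * D)\<^sup>2) (at p)" for A C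
    using D assms(2) unfolding D_def
    by (auto intro!: derivative_eq_intros simp: power2_eq_square algebra_simps)
  show ?thesis
    unfolding bml_loglik_eq D_def[symmetric]
    by (rule derivative_eq_intros ln quotient refl)+
       (use D assms(2) in \<open>simp add: field_simps power2_eq_square\<close>)
qed

lemma bml_loglik_deriv_sigma2:
  assumes "0 < s"
  shows "((\<lambda>s. bml_loglik q l x y (b, p, s)) has_real_derivative
     (error_squares q l x y b - 2 * p * error_products q l x y b) / (2 * s\<^sup>2 * (1 - p\<^sup>2)) -
     real q / s) (at s)"
proof -
  have deriv: "((\<lambda>s. - real q * ln (2 * pi) - real q * ln s - c - K / s) has_real_derivative
      K / s\<^sup>2 - real q / s) (at s)" for c K :: real
    using assms by (auto intro!: derivative_eq_intros simp: power2_eq_square)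
  \<comment> \<open>Isolates the variance in the form K/s; used with \<open>t\<close> as
    \<open>s\<close> in the function and as its square in the derivative.\<close>
  have "K / (2 * t * D) = K / (2 * D) / t" for K t D :: real
    by (simp add: mult_ac)
  then show ?thesis
    unfolding bml_loglik_eq by (simp only: deriv)
qed

lemma has_real_derivative_zero_iff:
  "(f has_real_derivative d) (at z) \<Longrightarrow> (f has_real_derivative 0) (at z) \<longleftrightarrow> d = 0"
  using DERIV_unique by blast

lemma likelihood_equations_iff_bml_system:
  assumes "1 \<le> q" "alpha1 q l x \<noteq> 0" "\<theta> \<in> bml_params"
  shows "likelihood_equations q l x y \<theta> \<longleftrightarrow> bml_system q l x y \<theta>"
proof -
  obtain b p s where \<theta>: "\<theta> = (b, p, s)"
    by (cases \<theta>)
  with assms(3) have p: "\<bar>p\<bar> < 1" and s: "0 < s"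
    by (auto simp: bml_params_def)
  define D where "D = 1 - p\<^sup>2"
  define A where "A = error_squares q l x y b"
  define C where "C = error_products q l x y b"
  have D: "D > 0"
    using one_minus_square_pos[OF p] by (simp add: D_def)
  have q: "real q > 0"
    using assms(1) by simp
  have beta: "((\<lambda>b. bml_loglik q l x y (b, p, s)) has_real_derivative 0) (at b) \<longleftrightarrow>
      b = (p * alpha4 q l x y - alpha3 q l x y) / (2 * p * alpha5 q l x - alpha1 q l x)"
    unfolding has_real_derivative_zero_iff[OF bml_loglik_deriv_beta]
    using two_correlation_alpha5_less_alpha1[OF assms(2) p] s D
    by (auto simp: D_def[symmetric] field_simps)
  have sigma2: "((\<lambda>s. bml_loglik q l x y (b, p, s)) has_real_derivative 0) (at s) \<longleftrightarrow>
      s = (A - 2 * p * C) / (2 * real q * D)"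
    unfolding has_real_derivative_zero_iff[OF bml_loglik_deriv_sigma2[OF s]]
  proof -
    have "(A - 2 * p * C) / (2 * s\<^sup>2 * D) - real q / s =
        (A - 2 * p * C - s * (2 * real q * D)) / (2 * s\<^sup>2 * D)"
      using s D by (simp add: field_simps power2_eq_square)
    also have "\<dots> = 0 \<longleftrightarrow> s * (2 * real q * D) = A - 2 * p * C"
      using s D by auto
    also have "\<dots> \<longleftrightarrow> s = (A - 2 * p * C) / (2 * real q * D)"
      using D q by (subst eq_divide_eq) simp
    finally show "(error_squares q l x y b - 2 * p * error_products q l x y b) /
        (2 * s\<^sup>2 * (1 - p\<^sup>2)) - real q / s = 0 \<longleftrightarrow>
        s = (A - 2 * p * C) / (2 * real q * D)"
      unfolding D_def A_def C_def .
  qed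
  \<comment> \<open>Under the variance equation A - 2pC is 2qDs, so the derivative becomes qp/D +
    C/(sD) - 2qp/D, which vanishes iff C = qps.\<close>
  have psi: "((\<lambda>p. bml_loglik q l x y (b, p, s)) has_real_derivative 0) (at p) \<longleftrightarrow>
      p = C / (real q * s)" if "s = (A - 2 * p * C) / (2 * real q * D)"
  proof -
    have AC: "A - 2 * p * C = 2 * real q * D * s"
      using that D q by (simp add: field_simps)
    have "((\<lambda>p. bml_loglik q l x y (b, p, s)) has_real_derivative 0) (at p) \<longleftrightarrow>
        real q * p / D + C / (s * D) - p * (2 * real q * D * s) / (s * D\<^sup>2) = 0"
      unfolding has_real_derivative_zero_iff[OF bml_loglik_deriv_psi[OF p s]]
      by (simp only: D_def[symmetric] A_def[symmetric] C_def[symmetric] AC)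
    also have "\<dots> \<longleftrightarrow> p = C / (real q * s)"
      using s D q by (auto simp: field_simps power2_eq_square)
    finally show ?thesis .
  qed
  have AC: "alpha2 q l y + b\<^sup>2 * alpha1 q l x - 2 * b * alpha3 q l x y - 2 * p * alpha6 q l y -
      2 * p * b\<^sup>2 * alpha5 q l x + 2 * p * b * alpha4 q l x y = A - 2 * p * C"
    by (simp add: A_def C_def error_squares_def error_products_def algebra_simps)
  have C: "alpha6 q l y - b * alpha4 q l x y + b\<^sup>2 * alpha5 q l x = C"
    by (simp add: C_def error_products_def)
  have "bml_system q l x y \<theta> \<longleftrightarrow>
      b = (p * alpha4 q l x y - alpha3 q l x y) / (2 * p * alpha5 q l x - alpha1 q l x) \<and>
      s = (A - 2 * p * C) / (2 * real q * D) \<and> p = C / (real q * s)"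
    unfolding \<theta> bml_system_def Let_def prod.case AC C D_def[symmetric] ..
  then show ?thesis
    unfolding \<theta> likelihood_equations_def using beta sigma2 psi by auto
qed

lemma bml_estimate_likelihood_equations:
  assumes "is_bml_estimate q l x y \<theta>"
  shows "likelihood_equations q l x y \<theta>"
proof -
  obtain b p s where \<theta>: "\<theta> = (b, p, s)"
    by (cases \<theta>)
  have mem: "(b, p, s) \<in> bml_params"
    and le: "\<And>\<eta>. \<eta> \<in> bml_params \<Longrightarrow> bml_loglik q l x y \<eta> \<le> bml_loglik q l x y (b, p, s)"
    using assms by (auto simp: is_bml_estimate_def is_arg_max_def \<theta> not_less)
  have p: "\<bar>p\<bar> < 1" and s: "0 < s"
    using mem by (auto simp: bml_params_def)
  \<comment> \<open>The slope is unrestricted, so any radius serves for the local maximum; 1 is an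
    arbitrary choice.\<close>
  have beta: "((\<lambda>b. bml_loglik q l x y (b, p, s)) has_real_derivative 0) (at b)"
    using bml_loglik_deriv_beta[of q l x y p s b]
      DERIV_local_max[OF bml_loglik_deriv_beta[of q l x y p s b], of 1] le mem
    by (auto simp: bml_params_def)
  have psi: "((\<lambda>p. bml_loglik q l x y (b, p, s)) has_real_derivative 0) (at p)"
  proof -
    \<comment> \<open>The radius is the distance from \<open>p\<close> to the nearer of the excluded
      endpoints -1 and 1.\<close>
    have "\<forall>p'. \<bar>p - p'\<bar> < 1 - \<bar>p\<bar> \<longrightarrow> bml_loglik q l x y (b, p', s) \<le> bml_loglik q l x y (b, p, s)"
      using s by (auto intro!: le simp: bml_params_def)
    then show ?thesis
      using bml_loglik_deriv_psi[OF p s, of q l x y b] p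
        DERIV_local_max[OF bml_loglik_deriv_psi[OF p s, of q l x y b], of "1 - \<bar>p\<bar>"]
      by (simp del: diff_gt_0_iff_gt)
  qed
  have sigma2: "((\<lambda>s. bml_loglik q l x y (b, p, s)) has_real_derivative 0) (at s)"
  proof -
    \<comment> \<open>Radius \<open>s\<close> keeps the variance positive.\<close>
    have "\<forall>s'. \<bar>s - s'\<bar> < s \<longrightarrow> bml_loglik q l x y (b, p, s') \<le> bml_loglik q l x y (b, p, s)"
      using p by (auto intro!: le simp: bml_params_def)
    then show ?thesis
      using bml_loglik_deriv_sigma2[OF s, of q l x y b p]
        DERIV_local_max[OF bml_loglik_deriv_sigma2[OF s, of q l x y b p] s] by simp
  qed
  show ?thesis
    using beta psi sigma2 by (simp add: likelihood_equations_def \<theta>)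
qed

text \<open>The maximiser \<open>z0\<close> itself satisfies \<open>Q\<close>, so a maximum over the
  restricted set reaches the value at \<open>z0\<close> and is therefore global.\<close>

lemma is_arg_max_restrict:
  fixes f :: "'a \<Rightarrow> 'b::linorder"
  assumes "\<And>z. is_arg_max f P z \<Longrightarrow> Q z" and "is_arg_max f P z0"
  shows "is_arg_max f P z \<longleftrightarrow> is_arg_max f (\<lambda>z. P z \<and> Q z) z"
  using assms unfolding is_arg_max_linorder by (meson order_trans)

text \<open>The system describes critical points, so the last claim selects its solutions of largest
  likelihood. Existence is a premise there: if all residuals vanish at some slope, the likelihood is
  unbounded as the variance tends to 0.\<close>

theorem theorem1:
  fixes M :: "'w measure" and n q :: nat and N :: "nat \<Rightarrow> nat set" and l :: "nat \<Rightarrow> nat"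
    and x :: "nat \<Rightarrow> real" and y \<epsilon> :: "nat \<Rightarrow> 'w \<Rightarrow> real" and \<beta> \<psi> \<sigma>2 :: real and \<omega> :: 'w
  assumes model: "bivariate_coding_model M n q N l x y \<epsilon> \<beta> \<psi> \<sigma>2"
    and regressor_nonzero: "alpha1 q l x \<noteq> 0"
    and outcome: "\<omega> \<in> space M"
  shows "(\<forall>\<theta>. is_bml_estimate q l x (\<lambda>i. y i \<omega>) \<theta> \<longrightarrow> bml_system q l x (\<lambda>i. y i \<omega>) \<theta>) \<and>
    (\<forall>\<theta> \<in> bml_params.
       likelihood_equations q l x (\<lambda>i. y i \<omega>) \<theta> \<longleftrightarrow> bml_system q l x (\<lambda>i. y i \<omega>) \<theta>) \<and>
    ((\<exists>\<theta>. is_bml_estimate q l x (\<lambda>i. y i \<omega>) \<theta>) \<longrightarrow>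
       (\<forall>\<theta>. is_bml_estimate q l x (\<lambda>i. y i \<omega>) \<theta> \<longleftrightarrow>
          is_arg_max (bml_loglik q l x (\<lambda>i. y i \<omega>))
            (\<lambda>\<theta>. \<theta> \<in> bml_params \<and> bml_system q l x (\<lambda>i. y i \<omega>) \<theta>) \<theta>))"
proof -
  let ?y = "\<lambda>i. y i \<omega>"
  have q: "1 \<le> q"
    using model by (rule bivariate_coding_model.q_pos)
  have equations: "likelihood_equations q l x ?y \<theta> \<longleftrightarrow> bml_system q l x ?y \<theta>"
    if "\<theta> \<in> bml_params" for \<theta>
    using likelihood_equations_iff_bml_system[OF q regressor_nonzero that] .
  have estimate: "bml_system q l x ?y \<theta>" if "is_bml_estimate q l x ?y \<theta>" for \<theta>
    using that bml_estimate_likelihood_equations[OF that] equations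
    by (simp add: is_bml_estimate_def is_arg_max_def)
  show ?thesis
    using equations estimate
      is_arg_max_restrict[where f = "bml_loglik q l x ?y" and P = "\<lambda>\<theta>. \<theta> \<in> bml_params"
        and Q = "bml_system q l x ?y"]
    unfolding is_bml_estimate_def by blast
qed

end
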